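(* Let $T$ be a regular tetrahedron in Euclidean $3$-space $\mathbb R^3$. Then the group of isometries of $\mathbb R^3$ generated by the automorphisms (isometric symmetries) of $T$ and the reflections across its facets is $$\bigl((\mathbb Z/2)*(\mathbb Z/2)*(\mathbb Z/2)*(\mathbb Z/2)\bigr)\rtimes\operatorname{Aut}(T),$$ where the four free factors are generated by the reflections across the four facets of $T$ and $\operatorname{Aut}(T)\cong\mathfrak S_4$ permutes the factors as it permutes the facets.
   Context: $\operatorname{Aut}(T)$ denotes the full group of isometries of $\mathbb R^3$ preserving $T$ (including orientation-reversing ones). The reflection across a facet of $T$ means the reflection of $\mathbb R^3$ in the plane containing that facet. *)

theory Defs
  imports "HOL-Analysis.Analysis" "HOL-Algebra.Algebra"
begin

section \<open>Free products of groups\<close>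

text \<open>The free product of a family of groups, in its normal-form model: elements are the
  reduced words, i.e. lists of pairs \<open>(i, g)\<close> with \<open>g\<close> a non-trivial element of the
  \<open>i\<close>-th group and neighbouring letters from different groups; the product is concatenation
  followed by reduction.  \<open>fp_cons\<close> multiplies a reduced word by one (possibly trivial)
  letter on the left.\<close>

fun fp_cons :: "('i \<Rightarrow> ('a, 'm) monoid_scheme) \<Rightarrow> 'i \<times> 'a \<Rightarrow> ('i \<times> 'a) list \<Rightarrow> ('i \<times> 'a) list"
  where
    "fp_cons G (i, g) [] = (if g = \<one>\<^bsub>G i\<^esub> then [] else [(i, g)])"
  | "fp_cons G (i, g) ((j, h) # w) =
       (if i = j
        then (if g \<otimes>\<^bsub>G i\<^esub> h = \<one>\<^bsub>G i\<^esub> then w else (i, g \<otimes>\<^bsub>G i\<^esub> h) # w)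
        else (if g = \<one>\<^bsub>G i\<^esub> then (j, h) # w else (i, g) # (j, h) # w))"

definition reduced_words :: "'i set \<Rightarrow> ('i \<Rightarrow> ('a, 'm) monoid_scheme) \<Rightarrow> ('i \<times> 'a) list set"
  where "reduced_words I G =
    {w. (\<forall>(i, g) \<in> set w. i \<in> I \<and> g \<in> carrier (G i) \<and> g \<noteq> \<one>\<^bsub>G i\<^esub>) \<and> distinct_adj (map fst w)}"

definition free_product :: "'i set \<Rightarrow> ('i \<Rightarrow> ('a, 'm) monoid_scheme) \<Rightarrow> ('i \<times> 'a) list monoid"
  where "free_product I G =
    \<lparr>carrier = reduced_words I G, mult = (\<lambda>v w. foldr (fp_cons G) v w), one = []\<rparr>"

definition fp_inj :: "('i \<Rightarrow> ('a, 'm) monoid_scheme) \<Rightarrow> 'i \<Rightarrow> 'a \<Rightarrow> ('i \<times> 'a) list"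
  where "fp_inj G i g = (if g = \<one>\<^bsub>G i\<^esub> then [] else [(i, g)])"

lemma carrier_free_product [simp]: "carrier (free_product I G) = reduced_words I G"
  and mult_free_product [simp]: "v \<otimes>\<^bsub>free_product I G\<^esub> w = foldr (fp_cons G) v w"
  and one_free_product [simp]: "\<one>\<^bsub>free_product I G\<^esub> = []"
  by (simp_all add: free_product_def)

lemma Nil_reduced [simp]: "[] \<in> reduced_words I G"
  by (simp add: reduced_words_def)

lemma Cons_reduced:
  "(i, g) # w \<in> reduced_words I G \<longleftrightarrow>
     i \<in> I \<and> g \<in> carrier (G i) \<and> g \<noteq> \<one>\<^bsub>G i\<^esub> \<and> w \<in> reduced_words I G \<and> (w = [] \<or> fst (hd w) \<noteq> i)"
  by (cases w) (auto simp: reduced_words_def)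

context
  fixes I :: "'i set" and G :: "'i \<Rightarrow> ('a, 'm) monoid_scheme"
  assumes grp: "\<And>i. i \<in> I \<Longrightarrow> group (G i)"
begin

lemma fp_cons_reduced:
  assumes "i \<in> I" "g \<in> carrier (G i)" "w \<in> reduced_words I G"
  shows "fp_cons G (i, g) w \<in> reduced_words I G"
proof -
  interpret group "G i" using grp assms by blast
  show ?thesis
    using assms by (cases "(G, (i, g), w)" rule: fp_cons.cases) (auto simp: Cons_reduced)
qed

lemma fp_cons_one:
  assumes "i \<in> I" "w \<in> reduced_words I G"
  shows "fp_cons G (i, \<one>\<^bsub>G i\<^esub>) w = w"
proof -
  interpret group "G i" using grp assms by blast
  show ?thesis
    using assms by (cases w) (auto simp: Cons_reduced)
qed

lemma fp_cons_fp_cons: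
  assumes "i \<in> I" "g \<in> carrier (G i)" "h \<in> carrier (G i)" "w \<in> reduced_words I G"
  shows "fp_cons G (i, g) (fp_cons G (i, h) w) = fp_cons G (i, g \<otimes>\<^bsub>G i\<^esub> h) w"
proof -
  interpret group "G i" using grp assms by blast
  show ?thesis
  proof (cases w)
    case Nil
    then show ?thesis using assms by auto
  next
    case (Cons x u)
    obtain j k where x: "x = (j, k)" by (cases x)
    show ?thesis
    proof (cases "i = j")
      case False
      then show ?thesis using assms Cons x by (auto simp: Cons_reduced)
    next
      case True
      then have k: "k \<in> carrier (G i)" "k \<noteq> \<one>\<^bsub>G i\<^esub>" and u: "u \<in> reduced_words I G" "u = [] \<or> fst (hd u) \<noteq> i"
        using assms Cons x by (auto simp: Cons_reduced)
      have fresh: "fp_cons G (i, l) u = (if l = \<one>\<^bsub>G i\<^esub> then u else (i, l) # u)" for l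
        using u by (cases u) auto
      show ?thesis
      proof (cases "h \<otimes>\<^bsub>G i\<^esub> k = \<one>\<^bsub>G i\<^esub>")
        case eq: True
        have "g \<otimes>\<^bsub>G i\<^esub> h \<otimes>\<^bsub>G i\<^esub> k = g"
          using eq assms k by (simp add: m_assoc)
        then show ?thesis using eq True Cons x fresh by simp
      next
        case False
        have "g \<otimes>\<^bsub>G i\<^esub> h \<otimes>\<^bsub>G i\<^esub> k = g \<otimes>\<^bsub>G i\<^esub> (h \<otimes>\<^bsub>G i\<^esub> k)"
          using assms k by (simp add: m_assoc)
        then show ?thesis using False True Cons x by simp
      qed
    qed
  qed
qed

lemma fp_mult_reduced:
  assumes "v \<in> reduced_words I G" "w \<in> reduced_words I G"
  shows "foldr (fp_cons G) v w \<in> reduced_words I G"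
  using assms by (induction v) (auto simp: Cons_reduced intro: fp_cons_reduced)

lemma fp_cons_mult:
  assumes "i \<in> I" "g \<in> carrier (G i)" "v \<in> reduced_words I G" "w \<in> reduced_words I G"
  shows "foldr (fp_cons G) (fp_cons G (i, g) v) w = fp_cons G (i, g) (foldr (fp_cons G) v w)"
proof -
  interpret group "G i" using grp assms by blast
  show ?thesis
  proof (cases v)
    case Nil
    then show ?thesis using assms fp_cons_one by auto
  next
    case (Cons x u)
    obtain j k where x: "x = (j, k)" by (cases x)
    have u: "foldr (fp_cons G) u w \<in> reduced_words I G"
      using assms Cons x by (auto simp: Cons_reduced intro: fp_mult_reduced)
    have vw: "foldr (fp_cons G) v w \<in> reduced_words I G"
      using assms by (auto intro: fp_mult_reduced)
    show ?thesis
    proof (cases "i = j")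
      case True
      have "fp_cons G (i, g) (fp_cons G (i, k) (foldr (fp_cons G) u w)) =
            fp_cons G (i, g \<otimes>\<^bsub>G i\<^esub> k) (foldr (fp_cons G) u w)"
        using assms Cons x True u by (intro fp_cons_fp_cons) (auto simp: Cons_reduced)
      then show ?thesis using True Cons x u assms fp_cons_one[of i "foldr (fp_cons G) u w"] by auto
    next
      case False
      then show ?thesis using Cons x vw assms fp_cons_one[of i "foldr (fp_cons G) v w"] by auto
    qed
  qed
qed

lemma fp_mult_assoc:
  assumes "u \<in> reduced_words I G" "v \<in> reduced_words I G" "w \<in> reduced_words I G"
  shows "foldr (fp_cons G) (foldr (fp_cons G) u v) w = foldr (fp_cons G) u (foldr (fp_cons G) v w)"
  using assms
proof (induction u)
  case (Cons x u)
  then show ?case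
    by (cases x) (auto simp: Cons_reduced fp_cons_mult fp_mult_reduced)
qed simp

lemma fp_mult_Nil: "v \<in> reduced_words I G \<Longrightarrow> foldr (fp_cons G) v [] = v"
proof (induction v)
  case (Cons x v)
  then show ?case by (cases x; cases v) (auto simp: Cons_reduced)
qed simp

lemma group_free_product: "group (free_product I G)"
proof (rule groupI)
  fix w assume "w \<in> carrier (free_product I G)"
  then have "w \<in> reduced_words I G" by simp
  then have "\<exists>v \<in> reduced_words I G. foldr (fp_cons G) v w = []"
  proof (induction w)
    case Nil
    show ?case by (rule bexI[of _ "[]"]) auto
  next
    case (Cons x w)
    obtain i g where x: "x = (i, g)" by (cases x)
    have i: "i \<in> I" "g \<in> carrier (G i)" "g \<noteq> \<one>\<^bsub>G i\<^esub>" and w: "w \<in> reduced_words I G"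
      using Cons.prems x by (auto simp: Cons_reduced)
    interpret group "G i" using grp i by blast
    obtain v where v: "v \<in> reduced_words I G" "foldr (fp_cons G) v w = []"
      using Cons.IH w by blast
    let ?l = "[(i, inv\<^bsub>G i\<^esub> g)]"
    have l: "?l \<in> reduced_words I G" using i by (auto simp: Cons_reduced)
    have "foldr (fp_cons G) (foldr (fp_cons G) v ?l) (x # w)
        = foldr (fp_cons G) v (foldr (fp_cons G) ?l (x # w))"
      using fp_mult_assoc v l Cons.prems by blast
    also have "foldr (fp_cons G) ?l (x # w) = w" using i x by simp
    finally show ?case using v l fp_mult_reduced by force
  qed
  then show "\<exists>v \<in> carrier (free_product I G). v \<otimes>\<^bsub>free_product I G\<^esub> w = \<one>\<^bsub>free_product I G\<^esub>"
    by simp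
qed (auto simp: fp_mult_reduced fp_mult_assoc)

lemma fp_inj_hom: "i \<in> I \<Longrightarrow> fp_inj G i \<in> hom (G i) (free_product I G)"
proof -
  assume i: "i \<in> I"
  interpret group "G i" using grp i by blast
  show ?thesis
    using i by (auto simp: hom_def fp_inj_def Cons_reduced)
qed

text \<open>The universal property of the free product.\<close>

theorem free_product_universal:
  assumes K: "group K" and f: "\<And>i. i \<in> I \<Longrightarrow> f i \<in> hom (G i) K"
  shows "\<exists>!h. h \<in> hom (free_product I G) K \<and> h \<in> extensional (carrier (free_product I G)) \<and>
              (\<forall>i \<in> I. \<forall>g \<in> carrier (G i). h (fp_inj G i g) = f i g)"
proof -
  interpret K: group K by fact
  define e where "e w = foldr (\<lambda>(i, g) k. f i g \<otimes>\<^bsub>K\<^esub> k) w \<one>\<^bsub>K\<^esub>" for w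
  have e_simps [simp]: "e [] = \<one>\<^bsub>K\<^esub>" "e ((i, g) # w) = f i g \<otimes>\<^bsub>K\<^esub> e w" for i g w
    by (simp_all add: e_def)
  have fK [simp]: "f i g \<in> carrier K" if "i \<in> I" "g \<in> carrier (G i)" for i g
    using f that by (auto simp: hom_def)
  have f1: "f i \<one>\<^bsub>G i\<^esub> = \<one>\<^bsub>K\<^esub>" if "i \<in> I" for i
    using hom_one[OF f grp K] that by blast
  have fm: "f i (g \<otimes>\<^bsub>G i\<^esub> h) = f i g \<otimes>\<^bsub>K\<^esub> f i h" if "i \<in> I" "g \<in> carrier (G i)" "h \<in> carrier (G i)" for i g h
    using f that by (auto simp: hom_def)
  have eK: "e w \<in> carrier K" if "w \<in> reduced_words I G" for w
    using that by (induction w) (auto simp: Cons_reduced)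
  have e_cons: "e (fp_cons G (i, g) w) = f i g \<otimes>\<^bsub>K\<^esub> e w"
    if "i \<in> I" "g \<in> carrier (G i)" "w \<in> reduced_words I G" for i g w
  proof (cases w)
    case Nil
    then show ?thesis using that f1 by auto
  next
    case (Cons x u)
    obtain j k where x: "x = (j, k)" by (cases x)
    have k: "j \<in> I" "k \<in> carrier (G j)" "e u \<in> carrier K"
      using that Cons x eK by (auto simp: Cons_reduced)
    show ?thesis
    proof (cases "i = j")
      case True
      have a: "f i g \<otimes>\<^bsub>K\<^esub> (f i k \<otimes>\<^bsub>K\<^esub> e u) = f i (g \<otimes>\<^bsub>G i\<^esub> k) \<otimes>\<^bsub>K\<^esub> e u"
        using that k True fm by (simp add: K.m_assoc)
      show ?thesis
        using a True Cons x k f1[of i] that by auto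
    next
      case False
      then show ?thesis using that Cons x k f1[of i] by auto
    qed
  qed
  have e_mult: "e (foldr (fp_cons G) v w) = e v \<otimes>\<^bsub>K\<^esub> e w"
    if "v \<in> reduced_words I G" "w \<in> reduced_words I G" for v w
    using that(1)
  proof (induction v)
    case Nil
    then show ?case using eK that by simp
  next
    case (Cons x v)
    then show ?case
      by (cases x) (auto simp: Cons_reduced e_cons fp_mult_reduced that eK K.m_assoc)
  qed
  show ?thesis
  proof (rule ex1I[of _ "restrict e (reduced_words I G)"])
    show "restrict e (reduced_words I G) \<in> hom (free_product I G) K \<and>
      restrict e (reduced_words I G) \<in> extensional (carrier (free_product I G)) \<and>
      (\<forall>i \<in> I. \<forall>g \<in> carrier (G i). restrict e (reduced_words I G) (fp_inj G i g) = f i g)"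
      by (auto simp: hom_def eK e_mult fp_mult_reduced fp_inj_def f1 Cons_reduced)
  next
    fix h assume h: "h \<in> hom (free_product I G) K \<and> h \<in> extensional (carrier (free_product I G)) \<and>
              (\<forall>i \<in> I. \<forall>g \<in> carrier (G i). h (fp_inj G i g) = f i g)"
    have "h w = e w" if "w \<in> reduced_words I G" for w
      using that
    proof (induction w)
      case Nil
      show ?case using hom_one[OF _ group_free_product K, of h] h by simp
    next
      case (Cons x w)
      obtain i g where x: "x = (i, g)" by (cases x)
      have i: "i \<in> I" "g \<in> carrier (G i)" "g \<noteq> \<one>\<^bsub>G i\<^esub>" and w: "w \<in> reduced_words I G"
        using Cons.prems x by (auto simp: Cons_reduced)
      have l: "[(i, g)] \<in> reduced_words I G" using i by (simp add: Cons_reduced)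
      have "x # w = foldr (fp_cons G) [(i, g)] w"
        using Cons.prems x by (cases w) (auto simp: Cons_reduced)
      then have "h (x # w) = h [(i, g)] \<otimes>\<^bsub>K\<^esub> h w"
        using hom_mult[of h "free_product I G" K "[(i, g)]" w] h w l by simp
      moreover have "h [(i, g)] = f i g"
        using h i by (auto simp: fp_inj_def dest!: bspec)
      ultimately show ?case using Cons.IH w x by simp
    qed
    then show "h = restrict e (reduced_words I G)"
      using h by (auto simp: extensional_def restrict_def)
  qed
qed

end


section \<open>Semidirect products\<close>

text \<open>The external semidirect product of \<open>N\<close> and \<open>H\<close> for an action
  \<open>\<alpha> : H \<rightarrow> Aut N\<close>, with multiplication \<open>(n, h) (n', h') = (n \<alpha>\<^sub>h(n'), h h')\<close>.\<close>

definition semidirect_product ::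
    "('a, 'm) monoid_scheme \<Rightarrow> ('b, 'n) monoid_scheme \<Rightarrow> ('b \<Rightarrow> 'a \<Rightarrow> 'a) \<Rightarrow> ('a \<times> 'b) monoid"
  where "semidirect_product N H \<alpha> =
    \<lparr>carrier = carrier N \<times> carrier H,
     mult = (\<lambda>(n, h) (n', h'). (n \<otimes>\<^bsub>N\<^esub> \<alpha> h n', h \<otimes>\<^bsub>H\<^esub> h')),
     one = (\<one>\<^bsub>N\<^esub>, \<one>\<^bsub>H\<^esub>)\<rparr>"

lemma group_semidirect_product:
  assumes "group N" "group H" and \<alpha>: "\<alpha> \<in> hom H (AutoGroup N)"
  shows "group (semidirect_product N H \<alpha>)"
proof -
  interpret N: group N by fact
  interpret H: group H by fact
  have aut: "\<alpha> h \<in> hom N N" "\<alpha> h \<in> Bij (carrier N)" if "h \<in> carrier H" for h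
    using \<alpha> that by (auto simp: hom_def[of H] AutoGroup_def auto_def)
  have cl [simp]: "\<alpha> h n \<in> carrier N" if "h \<in> carrier H" "n \<in> carrier N" for h n
    using aut that by (auto simp: hom_def)
  have mu: "\<alpha> h (n \<otimes>\<^bsub>N\<^esub> n') = \<alpha> h n \<otimes>\<^bsub>N\<^esub> \<alpha> h n'"
    if "h \<in> carrier H" "n \<in> carrier N" "n' \<in> carrier N" for h n n'
    using aut that by (auto simp: hom_def)
  have act: "\<alpha> (h \<otimes>\<^bsub>H\<^esub> h') n = \<alpha> h (\<alpha> h' n)"
    if "h \<in> carrier H" "h' \<in> carrier H" "n \<in> carrier N" for h h' n
    using hom_mult[OF \<alpha> that(1,2)] aut that
    by (simp add: AutoGroup_def BijGroup_def compose_eq)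
  have "\<alpha> \<one>\<^bsub>H\<^esub> = \<one>\<^bsub>AutoGroup N\<^esub>"
    using hom_one[OF \<alpha> \<open>group H\<close> N.AutoGroup] .
  then have one: "\<alpha> \<one>\<^bsub>H\<^esub> n = n" if "n \<in> carrier N" for n
    using that by (simp add: AutoGroup_def BijGroup_def)
  show ?thesis
  proof (rule groupI)
    fix x assume "x \<in> carrier (semidirect_product N H \<alpha>)"
    then obtain n h where x: "x = (n, h)" "n \<in> carrier N" "h \<in> carrier H"
      by (auto simp: semidirect_product_def)
    let ?k = "inv\<^bsub>H\<^esub> h"
    show "\<exists>y \<in> carrier (semidirect_product N H \<alpha>).
        y \<otimes>\<^bsub>semidirect_product N H \<alpha>\<^esub> x = \<one>\<^bsub>semidirect_product N H \<alpha>\<^esub>"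
      by (rule bexI[of _ "(inv\<^bsub>N\<^esub> (\<alpha> ?k n), ?k)"]) (use x in \<open>auto simp: semidirect_product_def\<close>)
  qed (auto simp: semidirect_product_def mu act one N.m_assoc H.m_assoc)
qed


section \<open>Isometries, reflections and regular tetrahedra\<close>

definition isometry_group :: "('a::metric_space \<Rightarrow> 'a) monoid"
  where "isometry_group =
    \<lparr>carrier = {f. bij f \<and> (\<forall>x y. dist (f x) (f y) = dist x y)}, mult = (\<circ>), one = id\<rparr>"

definition symmetry_group :: "'a::metric_space set \<Rightarrow> ('a \<Rightarrow> 'a) monoid"
  where "symmetry_group T = isometry_group\<lparr>carrier := {f \<in> carrier isometry_group. f ` T = T}\<rparr>"

text \<open>The reflection in an affine subspace \<open>A\<close>; \<open>closest_point A x\<close> is the orthogonal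
  projection of \<open>x\<close> to \<open>A\<close>.\<close>

definition reflection_in :: "'a::euclidean_space set \<Rightarrow> 'a \<Rightarrow> 'a"
  where "reflection_in A x = x + 2 *\<^sub>R (closest_point A x - x)"

definition facet_reflection :: "'a::euclidean_space set \<Rightarrow> 'a \<Rightarrow> 'a"
  where "facet_reflection F = reflection_in (affine hull F)"

definition facets :: "'a::euclidean_space set \<Rightarrow> 'a set set"
  where "facets T = {F. F facet_of T}"

definition regular_tetrahedron :: "(real ^ 3) set \<Rightarrow> bool"
  where "regular_tetrahedron T \<longleftrightarrow>
    (\<exists>V d. card V = 4 \<and> pairwise (\<lambda>x y. dist x y = d) V \<and> T = convex hull V)"

lemma group_isometry_group: "group (isometry_group :: ('a::metric_space \<Rightarrow> 'a) monoid)"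
proof (rule groupI)
  fix f :: "'a \<Rightarrow> 'a" assume "f \<in> carrier isometry_group"
  then have f: "bij f" "\<And>x y. dist (f x) (f y) = dist x y"
    by (auto simp: isometry_group_def)
  have "dist (inv_into UNIV f x) (inv_into UNIV f y) = dist x y" for x y
    using f by (metis bij_inv_eq_iff)
  with f show "\<exists>g \<in> carrier isometry_group. g \<otimes>\<^bsub>isometry_group\<^esub> f = \<one>\<^bsub>isometry_group\<^esub>"
    by (intro bexI[of _ "inv_into UNIV f"])
       (auto simp: isometry_group_def bij_imp_bij_inv bij_is_inj)
qed (auto simp: isometry_group_def bij_comp o_assoc)


section \<open>The groups in the theorem\<close>

text \<open>The free product of one copy of \<open>\<int>/2\<close> for each facet of \<open>T\<close>, and the action on
  it that relabels the free factors by the permutation of the facets induced by a symmetry.\<close>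

definition facet_free_product :: "'a::euclidean_space set \<Rightarrow> ('a set \<times> int) list monoid"
  where "facet_free_product T = free_product (facets T) (\<lambda>_. integer_mod_group 2)"

definition facet_action ::
    "'a::euclidean_space set \<Rightarrow> ('a \<Rightarrow> 'a) \<Rightarrow> ('a set \<times> int) list \<Rightarrow> ('a set \<times> int) list"
  where "facet_action T a =
    (\<lambda>w \<in> carrier (facet_free_product T). map (\<lambda>(F, g). (a ` F, g)) w)"

text \<open>The generator of the factor belonging to the facet \<open>F\<close>.\<close>

definition facet_generator :: "'a set \<Rightarrow> ('a set \<times> int) list"
  where "facet_generator F = fp_inj (\<lambda>_. integer_mod_group 2) F 1"

definition tetrahedron_group :: "'a::euclidean_space set \<Rightarrow> ('a \<Rightarrow> 'a) monoid"
  where "tetrahedron_group T =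
    subgroup_generated isometry_group (carrier (symmetry_group T) \<union> facet_reflection ` facets T)"

text \<open>\<open>subgroup_generated\<close> silently discards generators outside the ambient group; the
  following shows that nothing is discarded in \<open>tetrahedron_group\<close>.\<close>

lemma reflection_in_isometry:
  fixes A :: "'a::euclidean_space set"
  assumes "affine A" "A \<noteq> {}"
  shows "reflection_in A \<in> carrier isometry_group"
proof -
  have cl: "closed A" and cv: "convex A"
    using assms by (auto simp: affine_closed affine_imp_convex)
  define P where "P = closest_point A"
  have PA: "P x \<in> A" for x
    using cl assms by (simp add: P_def closest_point_in_set)
  have orth: "(x - P x) \<bullet> (z - P x) = 0" if z: "z \<in> A" for x z
  proof -
    have "2 *\<^sub>R P x + (- 1) *\<^sub>R z \<in> A"
      using assms(1) z PA[of x] by (intro mem_affine) auto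
    then have "(x - P x) \<bullet> ((2 *\<^sub>R P x + (- 1) *\<^sub>R z) - P x) \<le> 0"
      unfolding P_def using closest_point_dot cv cl by blast
    moreover have "(2 *\<^sub>R P x + (- 1) *\<^sub>R z) - P x = - (z - P x)"
      by (simp add: scaleR_2)
    moreover have "(x - P x) \<bullet> (z - P x) \<le> 0"
      unfolding P_def using closest_point_dot cv cl z by blast
    ultimately show ?thesis by (metis antisym inner_minus_right neg_le_0_iff_le)
  qed
  define r where "r = reflection_in A"
  have r: "r x = x + 2 *\<^sub>R (P x - x)" for x
    by (simp add: r_def reflection_in_def P_def)
  have "(norm (r x - r y))\<^sup>2 = (norm (x - y))\<^sup>2" for x y
  proof -
    have "(x - P x) \<bullet> (P y - P x) = 0" "(y - P y) \<bullet> (P x - P y) = 0"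
      using orth PA by auto
    then have o: "((x - P x) - (y - P y)) \<bullet> (P x - P y) = 0"
      by (simp add: inner_diff_left inner_diff_right)
    define u v where "u = (x - P x) - (y - P y)" and "v = P x - P y"
    have "x - y = v + u" "r x - r y = v - u"
      by (simp_all add: u_def v_def r scaleR_2 algebra_simps)
    moreover have "u \<bullet> v = 0" using o by (simp add: u_def v_def)
    ultimately show ?thesis
      by (simp add: power2_norm_eq_inner inner_add_left inner_add_right inner_diff_left
          inner_diff_right inner_commute)
  qed
  then have d: "dist (r x) (r y) = dist x y" for x y
    by (simp add: dist_norm)
  have "r (r x) = x" for x
  proof -
    let ?q = "P (r x)"
    define e where "e = P x - ?q"
    have "(r x - ?q) \<bullet> e = 0" "(x - P x) \<bullet> (?q - P x) = 0"
      using orth PA by (auto simp: e_def)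
    moreover have "r x - ?q = e - (x - P x)" "?q - P x = - e"
      by (simp_all add: r e_def scaleR_2 algebra_simps)
    ultimately have "e \<bullet> e = 0"
      by (simp add: inner_diff_left)
    then have "?q = P x" by (simp add: e_def)
    then show ?thesis by (simp add: r scaleR_2 algebra_simps)
  qed
  then have "bij r" by (rule involuntory_imp_bij)
  then show ?thesis using d by (simp add: isometry_group_def r_def)
qed

lemma generators_subset:
  "carrier (symmetry_group T) \<union> facet_reflection ` facets T \<subseteq> carrier isometry_group"
proof -
  have "facet_reflection F \<in> carrier isometry_group" if "F \<in> facets T" for F
    using that reflection_in_isometry[of "affine hull F"]
    by (auto simp: facets_def facet_of_def facet_reflection_def)
  then show ?thesis by (auto simp: symmetry_group_def)
qed

end

theory Submission
  imports Defs
begin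

text \<open>
  Let \<open>V\<close> be the vertex set of the regular tetrahedron \<open>T\<close>.  An isometry is affine, so a symmetry
  of \<open>T\<close> is determined by the permutation of \<open>V\<close> that it induces.  Every permutation of \<open>V\<close>
  occurs, because \<open>V\<close> is equidistant: the distance of two points depends only on the unordered
  collection of the differences of their barycentric coordinates
  (\<open>symmetry_group_iso_sym_group\<close>).

  Sending \<open>(w, a)\<close> to the product of the reflections named by the word \<open>w\<close>, composed on the
  right with the symmetry \<open>a\<close>, is a homomorphism from the semidirect product: facet reflections are
  involutions, and conjugating the reflection across \<open>F\<close> by \<open>a\<close> yields the reflection across
  \<open>a ` F\<close> (\<open>word_isometry_relabel\<close>).  Its image is generated by the symmetries and the reflections.

  Injectivity says that a nonempty reduced word of reflections is never a symmetry of \<open>T\<close>.  This is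
  a \<open>3\<close>-adic argument (\<open>word_isometry_denominator\<close>).  The reflection across the facet opposite
  to \<open>t\<close> changes barycentric coordinates by \<open>\<lambda>\<^sub>t \<mapsto> - \<lambda>\<^sub>t\<close> and
  \<open>\<lambda>\<^sub>u \<mapsto> \<lambda>\<^sub>u + (2/3) \<lambda>\<^sub>t\<close> for \<open>u \<noteq> t\<close>.  Suppose that
  \<open>3\<^sup>k\<close> times each coordinate is an integer, not divisible by 3 for the coordinate \<open>\<lambda>\<^sub>t\<close>.  Then after
  the reflection \<open>3\<^sup>k\<^sup>+\<^sup>1\<close> times each coordinate is an integer, not divisible by 3 for the coordinates
  \<open>\<lambda>\<^sub>u\<close> with \<open>u \<noteq> t\<close>.  As neighbouring letters of a reduced word differ, this persists from letter
  to letter, starting at the vertex where the first coordinate to be used is 1.  So a word of length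
  \<open>k > 0\<close> moves this vertex to a point with non-integral coordinates, which is not a vertex; but
  symmetries preserve \<open>V\<close>.
\<close>

section \<open>Isometries and symmetry groups\<close>

lemma isometry_groupD:
  assumes "f \<in> carrier isometry_group"
  shows "bij f" "dist (f x) (f y) = dist x y"
  using assms by (auto simp: isometry_group_def)

lemma mult_isometry_group [simp]: "f \<otimes>\<^bsub>isometry_group\<^esub> g = f \<circ> g"
  and one_isometry_group [simp]: "\<one>\<^bsub>isometry_group\<^esub> = id"
  by (simp_all add: isometry_group_def)

lemma isometry_affine:
  fixes f :: "'a::euclidean_space \<Rightarrow> 'a"
  assumes "\<And>x y. dist (f x) (f y) = dist x y"
  obtains h b where "orthogonal_transformation h" "\<And>x. f x = b + h x"
proof
  show "orthogonal_transformation (\<lambda>x. f x - f 0)"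
    unfolding orthogonal_transformation_isometry
    using assms by (simp add: dist_norm)
  show "f x = f 0 + (f x - f 0)" for x
    by simp
qed

lemma isometry_groupI:
  fixes f :: "'a::euclidean_space \<Rightarrow> 'a"
  assumes "\<And>x y. dist (f x) (f y) = dist x y"
  shows "f \<in> carrier isometry_group"
proof -
  obtain h b where h: "orthogonal_transformation h" and f: "\<And>x. f x = b + h x"
    using isometry_affine[OF assms] by blast
  have "f = (\<lambda>x. b + x) \<circ> h" using f by auto
  then have "bij f"
    using bij_comp[OF orthogonal_transformation_bij[OF h], of "\<lambda>x. b + x"] by simp
  then show ?thesis using assms by (simp add: isometry_group_def)
qed

lemma isometry_convex_hull_image:
  fixes f :: "'a::euclidean_space \<Rightarrow> 'a"
  assumes "f \<in> carrier isometry_group"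
  shows "f ` (convex hull S) = convex hull (f ` S)"
proof -
  obtain h b where h: "orthogonal_transformation h" and f: "\<And>x. f x = b + h x"
    using isometry_affine[OF isometry_groupD(2)[OF assms]] by blast
  have image: "f ` A = (\<lambda>x. b + x) ` h ` A" for A
    by (simp add: f image_image)
  have "f ` (convex hull S) = (\<lambda>x. b + x) ` (convex hull (h ` S))"
    using orthogonal_transformation_linear[OF h] by (simp add: image convex_hull_linear_image)
  also have "\<dots> = convex hull (f ` S)"
    by (simp only: image convex_hull_translation)
  finally show ?thesis .
qed

lemma isometry_affine_hull_image:
  fixes f :: "'a::euclidean_space \<Rightarrow> 'a"
  assumes "f \<in> carrier isometry_group"
  shows "f ` (affine hull S) = affine hull (f ` S)"
proof -
  obtain h b where h: "orthogonal_transformation h" and f: "\<And>x. f x = b + h x"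
    using isometry_affine[OF isometry_groupD(2)[OF assms]] by blast
  have image: "f ` A = (\<lambda>x. b + x) ` h ` A" for A
    by (simp add: f image_image)
  have "f ` (affine hull S) = (\<lambda>x. b + x) ` (affine hull (h ` S))"
    using orthogonal_transformation_linear[OF h]
    by (simp add: image affine_hull_linear_image linear_conv_bounded_linear)
  also have "\<dots> = affine hull (f ` S)"
    by (simp only: image affine_hull_translation)
  finally show ?thesis .
qed

text \<open>
  An isometry is affine, hence determined by its values on an affinely spanning set such as the
  vertices of a tetrahedron.
\<close>

lemma isometry_affine_combination:
  fixes f :: "'a::euclidean_space \<Rightarrow> 'a"
  assumes "f \<in> carrier isometry_group" "sum c S = 1"
  shows "f (\<Sum>v\<in>S. c v *\<^sub>R v) = (\<Sum>v\<in>S. c v *\<^sub>R f v)"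
proof -
  obtain h b where h: "orthogonal_transformation h" and f: "\<And>x. f x = b + h x"
    using isometry_affine[OF isometry_groupD(2)[OF assms(1)]] by blast
  have "(\<Sum>v\<in>S. c v *\<^sub>R f v) = (\<Sum>v\<in>S. c v *\<^sub>R b) + (\<Sum>v\<in>S. c v *\<^sub>R h v)"
    by (simp only: f scaleR_add_right sum.distrib)
  also have "(\<Sum>v\<in>S. c v *\<^sub>R b) = b"
    using assms(2) by (simp flip: scaleR_left.sum)
  also have "(\<Sum>v\<in>S. c v *\<^sub>R h v) = h (\<Sum>v\<in>S. c v *\<^sub>R v)"
    using orthogonal_transformation_linear[OF h] by (simp add: linear_sum linear_scale)
  finally show ?thesis by (simp add: f)
qed

lemma closest_point_isometry_image:
  fixes A :: "'a::euclidean_space set"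
  assumes f: "f \<in> carrier isometry_group" and A: "affine A" "A \<noteq> {}"
  shows "closest_point (f ` A) (f x) = f (closest_point A x)"
proof (rule sym, rule closest_point_unique)
  have "affine (f ` A)"
    using isometry_affine_hull_image[OF f, of A] A by (metis affine_affine_hull hull_same)
  then show "convex (f ` A)" "closed (f ` A)"
    by (simp_all add: affine_imp_convex affine_closed)
  have A': "closed A" using A by (simp add: affine_closed)
  show "f (closest_point A x) \<in> f ` A"
    using closest_point_in_set A' A by blast
  show "\<forall>z\<in>f ` A. dist (f x) (f (closest_point A x)) \<le> dist (f x) z"
    using closest_point_le[OF A'] isometry_groupD(2)[OF f] by auto
qed

text \<open>
  The relation \<open>a s\<^sub>F a\<^sup>-\<^sup>1 = s\<^sub>a\<^sub>F\<close>, which makes the symmetries act on the reflections by permuting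
  facets.  It holds because an isometry is affine and the orthogonal projection to a plane is a nearest
  point, hence defined by distances alone.
\<close>

lemma facet_reflection_isometry_image:
  fixes F :: "'a::euclidean_space set"
  assumes f: "f \<in> carrier isometry_group" and "F \<noteq> {}"
  shows "facet_reflection (f ` F) (f x) = f (facet_reflection F x)"
proof -
  obtain h b where h: "orthogonal_transformation h" and fx: "\<And>x. f x = b + h x"
    using isometry_affine[OF isometry_groupD(2)[OF f]] by blast
  have lin: "linear h" using h by (rule orthogonal_transformation_linear)
  have "facet_reflection (f ` F) (f x)
      = f x + 2 *\<^sub>R (f (closest_point (affine hull F) x) - f x)"
    unfolding facet_reflection_def reflection_in_def isometry_affine_hull_image[OF f, symmetric]
    using assms by (subst closest_point_isometry_image[OF f]) auto
  also have "\<dots> = f (facet_reflection F x)"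
    using lin by (simp add: facet_reflection_def reflection_in_def fx linear_add linear_diff linear_scale)
  finally show ?thesis .
qed

lemma inv_isometry_group:
  assumes "f \<in> carrier isometry_group"
  shows "inv\<^bsub>isometry_group\<^esub> f = inv_into UNIV f"
proof -
  interpret group isometry_group by (rule group_isometry_group)
  have "inv\<^bsub>isometry_group\<^esub> f \<circ> f = id"
    using l_inv[OF assms] by simp
  moreover have "f \<circ> inv_into UNIV f = id"
    using isometry_groupD(1)[OF assms] bij_is_surj surj_iff by blast
  ultimately show ?thesis
    by (metis comp_assoc comp_id id_comp)
qed

lemma symmetry_group_simps [simp]:
  "f \<otimes>\<^bsub>symmetry_group T\<^esub> g = f \<circ> g" "\<one>\<^bsub>symmetry_group T\<^esub> = id"
  by (simp_all add: symmetry_group_def)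

lemma symmetry_groupD:
  assumes "f \<in> carrier (symmetry_group T)"
  shows "f \<in> carrier isometry_group" "f ` T = T"
  using assms by (auto simp: symmetry_group_def)

lemma group_symmetry_group: "group (symmetry_group T)"
proof -
  interpret group isometry_group by (rule group_isometry_group)
  have "subgroup {f \<in> carrier isometry_group. f ` T = T} isometry_group"
  proof (rule subgroupI)
    show "{f \<in> carrier isometry_group. f ` T = T} \<noteq> {}"
      using one_closed by force
  next
    fix f assume f: "f \<in> {f \<in> carrier isometry_group. f ` T = T}"
    then have "inv_into UNIV f ` (f ` T) = T"
      using image_inv_f_f[OF bij_is_inj[OF isometry_groupD(1)]] by blast
    then have "inv_into UNIV f ` T = T"
      using f by simp
    then show "inv\<^bsub>isometry_group\<^esub> f \<in> {f \<in> carrier isometry_group. f ` T = T}"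
      using f inv_closed[of f] by (simp add: inv_isometry_group)
  next
    fix f g :: "'a \<Rightarrow> 'a"
    assume fg: "f \<in> {f \<in> carrier isometry_group. f ` T = T}" "g \<in> {f \<in> carrier isometry_group. f ` T = T}"
    then have "f ` T = T" "g ` T = T"
      by auto
    then have "(f \<circ> g) ` T = T"
      by (simp only: image_comp[symmetric])
    with fg show "f \<otimes>\<^bsub>isometry_group\<^esub> g \<in> {f \<in> carrier isometry_group. f ` T = T}"
      using m_closed[of f g] by simp
  qed auto
  then show ?thesis
    unfolding symmetry_group_def by (rule subgroup.subgroup_is_group) (rule group_isometry_group)
qed

section \<open>Barycentric coordinates of a regular tetrahedron\<close>

locale equidistant_quadruple =
  fixes V :: "(real ^ 3) set" and d :: real
  assumes card_V: "card V = 4"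
    and equidistant: "pairwise (\<lambda>x y. dist x y = d) V"
begin

abbreviation "T \<equiv> convex hull V"

lemma finite_V: "finite V"
  using card_V by (metis card.infinite zero_neq_numeral)

lemma dist_V: "u \<in> V \<Longrightarrow> v \<in> V \<Longrightarrow> dist u v = (if u = v then 0 else d)"
  using equidistant by (auto simp: pairwise_def)

lemma exists_other_vertex: "\<exists>v \<in> V. v \<noteq> u"
proof (rule ccontr)
  assume "\<not> ?thesis"
  then have "V \<subseteq> {u}" by auto
  then have "card V \<le> card {u}" by (intro card_mono) auto
  then show False using card_V by simp
qed

lemma d_pos: "d > 0"
proof -
  obtain u where u: "u \<in> V" using card_V by fastforce
  obtain v where "v \<in> V" "v \<noteq> u" using exists_other_vertex by blast
  then show ?thesis using dist_V[OF u, of v] by (metis u zero_less_dist_iff)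
qed

definition center :: "real ^ 3"
  where "center = (1/4) *\<^sub>R \<Sum>V"

lemma inner_vertices:
  assumes "u \<in> V" "v \<in> V"
  shows "u \<bullet> v = (u \<bullet> u + v \<bullet> v) / 2 - (if u = v then 0 else d\<^sup>2 / 2)"
proof -
  have "(dist u v)\<^sup>2 = u \<bullet> u + v \<bullet> v - 2 * (u \<bullet> v)"
    by (simp add: dist_norm power2_norm_eq_inner algebra_simps inner_commute)
  then show ?thesis using dist_V[OF assms] by (cases "u = v") (simp_all add: field_simps)
qed

text \<open>
  The Gram matrix of the vertices seen from the center.  By polarization all inner products are
  known from the squared distances and the \<open>v \<bullet> v\<close>; the latter cancel after centering.
\<close>

lemma inner_centered_vertices:
  assumes "u \<in> V" "v \<in> V"
  shows "(u - center) \<bullet> (v - center) = (if u = v then 3/8 * d\<^sup>2 else - d\<^sup>2 / 8)"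
proof -
  \<comment> \<open>The sum of the squared norms depends on the position of the origin; it cancels at the end.\<close>
  define Q where "Q = (\<Sum>w\<in>V. w \<bullet> w)"
  have row: "x \<bullet> \<Sum>V = 2 * (x \<bullet> x) + Q / 2 - 3/2 * d\<^sup>2" if x: "x \<in> V" for x
  proof -
    have "x \<bullet> \<Sum>V = (\<Sum>w\<in>V. (x \<bullet> x + w \<bullet> w) / 2 - (if x = w then 0 else d\<^sup>2 / 2))"
      by (simp only: inner_sum_right, rule sum.cong) (use inner_vertices[OF x] in auto)
    also have "\<dots> = (\<Sum>w\<in>V. (x \<bullet> x + w \<bullet> w) / 2 - d\<^sup>2 / 2 + (if x = w then d\<^sup>2 / 2 else 0))"
      by (rule sum.cong) auto
    also have "\<dots> = 4 * (x \<bullet> x) / 2 + Q / 2 - 4 * (d\<^sup>2 / 2) + d\<^sup>2 / 2"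
      using x finite_V card_V
      by (simp add: sum.distrib sum_subtractf Q_def flip: sum_divide_distrib)
    finally show ?thesis by (simp add: field_simps)
  qed
  have "\<Sum>V \<bullet> \<Sum>V = (\<Sum>x\<in>V. 2 * (x \<bullet> x) + Q / 2 - 3/2 * d\<^sup>2)"
    by (simp only: inner_sum_left, rule sum.cong) (use row in auto)
  also have "\<dots> = 4 * Q - 6 * d\<^sup>2"
    using card_V by (simp add: sum.distrib sum_subtractf Q_def flip: sum_distrib_left)
  finally have all: "\<Sum>V \<bullet> \<Sum>V = 4 * Q - 6 * d\<^sup>2" .
  have "(u - center) \<bullet> (v - center)
      = u \<bullet> v - (1/4) * (u \<bullet> \<Sum>V) - (1/4) * (v \<bullet> \<Sum>V) + (1/16) * (\<Sum>V \<bullet> \<Sum>V)"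
    by (simp add: center_def inner_diff_left inner_diff_right inner_commute)
  then show ?thesis
    using inner_vertices[OF assms]
    by (cases "u = v") (simp_all add: row assms all field_simps)
qed

text \<open>
  For \<open>u\<close> in \<open>V\<close> this is the barycentric coordinate belonging to the vertex \<open>u\<close>: the affine
  function with value 1 at \<open>u\<close> and 0 at the other three vertices.  Writing it as an inner product
  gives at once a normal vector of the plane of the facet opposite to \<open>u\<close>.
\<close>

definition bary :: "real ^ 3 \<Rightarrow> real ^ 3 \<Rightarrow> real"
  where "bary u x = 1/4 + 2 * ((x - center) \<bullet> (u - center)) / d\<^sup>2"

lemma inner_eq_bary: "(x - center) \<bullet> (u - center) = (bary u x - 1/4) * d\<^sup>2 / 2"
  using d_pos by (simp add: bary_def)

lemma bary_vertex:
  "u \<in> V \<Longrightarrow> v \<in> V \<Longrightarrow> bary u v = (if u = v then 1 else 0)"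
  using d_pos by (auto simp: bary_def inner_centered_vertices)

lemma bary_affine_combination:
  assumes "sum c S = 1"
  shows "bary u (\<Sum>v\<in>S. c v *\<^sub>R v) = (\<Sum>v\<in>S. c v * bary u v)"
proof -
  have "(\<Sum>v\<in>S. c v *\<^sub>R v) - center = (\<Sum>v\<in>S. c v *\<^sub>R (v - center))"
    using assms by (simp add: scaleR_diff_right sum_subtractf flip: scaleR_left.sum)
  then have "bary u (\<Sum>v\<in>S. c v *\<^sub>R v)
      = 1/4 * sum c S + (\<Sum>v\<in>S. c v * (2 * ((v - center) \<bullet> (u - center)) / d\<^sup>2))"
    using assms
    by (simp add: bary_def inner_sum_left sum_distrib_left sum_divide_distrib mult.left_commute)
  also have "\<dots> = (\<Sum>v\<in>S. c v * bary u v)"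
    by (simp add: bary_def distrib_left sum.distrib sum_distrib_left mult.commute)
  finally show ?thesis .
qed

lemma bary_vertex_combination:
  assumes "sum c V = 1" "u \<in> V"
  shows "bary u (\<Sum>v\<in>V. c v *\<^sub>R v) = c u"
proof -
  have "(\<Sum>v\<in>V. c v * bary u v) = (\<Sum>v\<in>V. if u = v then c v else 0)"
    using bary_vertex assms(2) by (intro sum.cong) auto
  then show ?thesis
    using assms finite_V by (simp add: bary_affine_combination)
qed

lemma affine_independent_V: "\<not> affine_dependent V"
proof
  assume "affine_dependent V"
  then obtain c u where c: "sum c V = 0" "(\<Sum>v\<in>V. c v *\<^sub>R v) = 0" and u: "u \<in> V" "c u \<noteq> 0"
    using affine_dependent_explicit_finite[OF finite_V] by blast
  \<comment> \<open>Adding the dependency to the combination \<open>u = 1 u\<close> changes the coefficient, not the point.\<close>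
  define b where "b v = c v + (if v = u then 1 else 0)" for v
  have "sum b V = 1"
    using c u finite_V by (simp add: b_def sum.distrib)
  moreover have "(\<Sum>v\<in>V. b v *\<^sub>R v) = (\<Sum>v\<in>V. c v *\<^sub>R v + (if v = u then v else 0))"
    by (rule sum.cong) (auto simp: b_def scaleR_add_left)
  then have "(\<Sum>v\<in>V. b v *\<^sub>R v) = u"
    using c u finite_V by (simp add: sum.distrib)
  ultimately have "bary u u = b u"
    using bary_vertex_combination u by metis
  then show False using u bary_vertex by (simp add: b_def)
qed

lemma affine_hull_V: "affine hull V = UNIV"
  using aff_dim_affine_independent[OF affine_independent_V] card_V
  by (simp flip: aff_dim_eq_full)

lemma bary_expansion:
  shows "(\<Sum>v\<in>V. bary v x) = 1" and "(\<Sum>v\<in>V. bary v x *\<^sub>R v) = x"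
proof -
  have "x \<in> affine hull V" by (simp add: affine_hull_V)
  then obtain c where c: "sum c V = 1" "(\<Sum>v\<in>V. c v *\<^sub>R v) = x"
    using affine_hull_finite[OF finite_V] by auto
  then have "bary v x = c v" if "v \<in> V" for v
    using bary_vertex_combination that by blast
  then show "(\<Sum>v\<in>V. bary v x) = 1" "(\<Sum>v\<in>V. bary v x *\<^sub>R v) = x"
    using c by auto
qed

section \<open>Facets and their reflections\<close>

definition opposite_facet :: "real ^ 3 \<Rightarrow> (real ^ 3) set"
  where "opposite_facet u = convex hull (V - {u})"

lemma affine_hull_opposite_facet:
  assumes u: "u \<in> V"
  shows "affine hull (opposite_facet u) = {x. bary u x = 0}"
proof -
  define r where "r = (u - center) \<bullet> center - d\<^sup>2 / 8"
  have plane: "{x. bary u x = 0} = {x. (u - center) \<bullet> x = r}"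
    using d_pos by (auto simp: bary_def r_def field_simps inner_diff_left inner_diff_right inner_commute)
  have nz: "u - center \<noteq> 0"
    using inner_centered_vertices[OF u u] d_pos by auto
  \<comment> \<open>Both sides are affine of dimension 2, so one inclusion is enough.\<close>
  have "affine hull (V - {u}) = {x. bary u x = 0}"
  proof (rule affine_dim_equal)
    show "affine {x. bary u x = 0}"
      by (simp add: plane affine_hyperplane)
    show "affine hull (V - {u}) \<noteq> {}"
      using exists_other_vertex[of u] by auto
    have "V - {u} \<subseteq> {x. bary u x = 0}"
      using u bary_vertex by auto
    then show "affine hull (V - {u}) \<subseteq> {x. bary u x = 0}"
      by (simp add: hull_minimal plane affine_hyperplane)
    have "\<not> affine_dependent (V - {u})"
      using affine_independent_V affine_dependent_subset by blast
    then have "aff_dim (V - {u}) = 2"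
      using aff_dim_affine_independent[of "V - {u}"] u card_V finite_V by simp
    then show "aff_dim (affine hull (V - {u})) = aff_dim {x. bary u x = 0}"
      using nz by (simp add: plane)
  qed simp
  then show ?thesis by (simp add: opposite_facet_def affine_hull_convex_hull)
qed

lemma inj_on_opposite_facet: "inj_on opposite_facet V"
proof
  fix u v assume uv: "u \<in> V" "v \<in> V" "opposite_facet u = opposite_facet v"
  then have "{x. bary u x = 0} = {x. bary v x = 0}"
    by (simp flip: affine_hull_opposite_facet)
  then have "bary u v = 0 \<longleftrightarrow> bary v v = 0" by blast
  then show "u = v" using bary_vertex uv by (simp split: if_splits)
qed

lemma facets_eq: "facets (convex hull V) = opposite_facet ` V"
proof -
  have "opposite_facet u \<noteq> {}" for u
    using exists_other_vertex[of u] by (auto simp: opposite_facet_def)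
  then show ?thesis
    unfolding facets_def facet_of_convex_hull_affine_independent[OF affine_independent_V]
    by (auto simp: opposite_facet_def)
qed

text \<open>
  The segment from \<open>x\<close> to its projection is parallel to the normal \<open>u - center\<close>, along which the
  coordinate of \<open>u\<close> grows at rate \<open>3/4\<close>.  So the plane is reached by going back \<open>4/3\<close> times
  the coordinate, and the mirror image by going back twice as far.
\<close>

lemma facet_reflection_opposite_facet:
  assumes u: "u \<in> V"
  shows "facet_reflection (opposite_facet u) x = x - (8/3 * bary u x) *\<^sub>R (u - center)"
proof -
  let ?n = "u - center"
  define p where "p = x - (4/3 * bary u x) *\<^sub>R ?n"
  have n: "?n \<bullet> ?n = 3/8 * d\<^sup>2" using inner_centered_vertices[OF u u] by simp
  have "(p - center) \<bullet> ?n = (x - center) \<bullet> ?n - 4/3 * bary u x * (?n \<bullet> ?n)"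
    by (simp add: p_def inner_diff_left)
  also have "\<dots> = - d\<^sup>2 / 8"
    unfolding n inner_eq_bary[of x u] by (simp add: field_simps)
  finally have p0: "bary u p = 0"
    using d_pos by (simp add: bary_def)
  have "p = closest_point {x. bary u x = 0} x"
  proof (rule closest_point_unique)
    have "affine {x. bary u x = 0}"
      by (metis affine_affine_hull affine_hull_opposite_facet[OF u])
    then show "convex {x. bary u x = 0}" "closed {x. bary u x = 0}"
      by (simp_all add: affine_imp_convex affine_closed)
    show "\<forall>z\<in>{x. bary u x = 0}. dist x p \<le> dist x z"
    proof
      fix z assume "z \<in> {x. bary u x = 0}"
      then have "(p - center) \<bullet> ?n = (z - center) \<bullet> ?n"
        using p0 by (simp add: inner_eq_bary)
      then have "?n \<bullet> (p - z) = 0"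
        by (simp add: inner_diff_left inner_diff_right inner_commute)
      then have o: "(x - p) \<bullet> (p - z) = 0"
        by (simp add: p_def)
      have "(norm (x - p))\<^sup>2 \<le> (norm (x - p))\<^sup>2 + (norm (p - z))\<^sup>2"
        by simp
      also have "\<dots> = (norm ((x - p) + (p - z)))\<^sup>2"
        using o by (simp only: power2_norm_eq_inner inner_add_left inner_add_right
            inner_commute[of "p - z" "x - p"])
      finally have "(norm (x - p))\<^sup>2 \<le> (norm (x - z))\<^sup>2" by simp
      then show "dist x p \<le> dist x z"
        by (simp add: dist_norm)
    qed
  qed (use p0 in simp)
  then have "facet_reflection (opposite_facet u) x = x + 2 *\<^sub>R (p - x)"
    by (simp add: facet_reflection_def reflection_in_def affine_hull_opposite_facet[OF u])
  then show ?thesis by (simp add: p_def)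
qed

text \<open>
  The coefficient \<open>2/3\<close> is the source of the powers of 3 in the denominators below: the mirror
  image of \<open>u\<close> is \<open>- u\<close> plus \<open>2/3\<close> of the sum of the other vertices.
\<close>

lemma bary_facet_reflection:
  assumes "u \<in> V" "w \<in> V"
  shows "bary w (facet_reflection (opposite_facet u) x)
    = (if w = u then - bary u x else bary w x + 2/3 * bary u x)"
proof -
  have "(facet_reflection (opposite_facet u) x - center) \<bullet> (w - center)
      = (x - center) \<bullet> (w - center) - 8/3 * bary u x * ((u - center) \<bullet> (w - center))"
    by (simp add: facet_reflection_opposite_facet assms inner_diff_left)
  also have "(x - center) \<bullet> (w - center) = (bary w x - 1/4) * d\<^sup>2 / 2"
    by (rule inner_eq_bary)
  finally have "bary w (facet_reflection (opposite_facet u) x) = 1/4 +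
      2 * ((bary w x - 1/4) * d\<^sup>2 / 2 - 8/3 * bary u x * ((u - center) \<bullet> (w - center))) / d\<^sup>2"
    by (simp only: bary_def[of w "facet_reflection _ x"])
  then show ?thesis
    using d_pos assms
    by (cases "w = u") (simp_all add: inner_centered_vertices add_divide_distrib diff_divide_distrib)
qed

lemma facet_reflection_involution:
  assumes "u \<in> V"
  shows "facet_reflection (opposite_facet u) (facet_reflection (opposite_facet u) x) = x"
proof -
  define y where "y = facet_reflection (opposite_facet u) x"
  have "bary u y = - bary u x"
    using assms by (simp add: y_def bary_facet_reflection)
  then have "facet_reflection (opposite_facet u) y = y + (8/3 * bary u x) *\<^sub>R (u - center)"
    using facet_reflection_opposite_facet[OF assms, of y] by simp
  then show ?thesis
    using facet_reflection_opposite_facet[OF assms, of x] by (simp add: y_def)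
qed

section \<open>Symmetries as permutations of the vertices\<close>

text \<open>
  The image of \<open>V\<close> is again equidistant and has the same convex hull, and an affinely independent
  set is recovered from its convex hull as the set of extreme points.
\<close>

lemma symmetry_image_V:
  assumes f: "f \<in> carrier (symmetry_group (convex hull V))"
  shows "f ` V = V"
proof -
  have iso: "f \<in> carrier isometry_group" and T: "f ` (convex hull V) = convex hull V"
    using f by (auto simp: symmetry_group_def)
  have inj: "inj f" using isometry_groupD(1)[OF iso] by (simp add: bij_is_inj)
  interpret W: equidistant_quadruple "f ` V" d
  proof
    show "card (f ` V) = 4"
      using card_V card_image[OF inj_on_subset[OF inj subset_UNIV]] by metis
    show "pairwise (\<lambda>x y. dist x y = d) (f ` V)"
      using equidistant isometry_groupD(2)[OF iso] by (auto simp: pairwise_def)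
  qed
  have "convex hull (f ` V) = convex hull V"
    using T isometry_convex_hull_image[OF iso] by metis
  then show ?thesis
    using extreme_point_of_convex_hull_affine_independent[OF affine_independent_V]
      extreme_point_of_convex_hull_affine_independent[OF W.affine_independent_V]
    by (metis subsetI subset_antisym)
qed

lemma isometry_eq_vertex_combination:
  assumes "f \<in> carrier isometry_group"
  shows "f x = (\<Sum>v\<in>V. bary v x *\<^sub>R f v)"
  using isometry_affine_combination[OF assms bary_expansion(1)[of x]] bary_expansion(2)[of x]
  by simp

text \<open>
  The right-hand side does not involve \<open>p\<close>: this is why permuting the vertices extends to an
  isometry.
\<close>

lemma norm_vertex_combination:
  assumes c: "sum c V = 0" and p: "p ` V \<subseteq> V" "inj_on p V"
  shows "(norm (\<Sum>v\<in>V. c v *\<^sub>R p v))\<^sup>2 = d\<^sup>2 / 2 * (\<Sum>v\<in>V. (c v)\<^sup>2)"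
proof -
  have "(\<Sum>v\<in>V. c v *\<^sub>R p v) = (\<Sum>v\<in>V. c v *\<^sub>R (p v - center))"
    using c by (simp add: scaleR_diff_right sum_subtractf flip: scaleR_left.sum)
  then have "(norm (\<Sum>v\<in>V. c v *\<^sub>R p v))\<^sup>2
      = (\<Sum>v\<in>V. \<Sum>w\<in>V. c v * c w * ((p v - center) \<bullet> (p w - center)))"
    by (simp add: power2_norm_eq_inner inner_sum_left inner_sum_right sum_distrib_left
        mult.assoc mult.left_commute inner_commute)
  also have "\<dots> = (\<Sum>v\<in>V. d\<^sup>2 / 2 * (c v)\<^sup>2)"
  proof (rule sum.cong)
    fix v assume v: "v \<in> V"
    have "(\<Sum>w\<in>V. c v * c w * ((p v - center) \<bullet> (p w - center)))
        = (\<Sum>w\<in>V. - (d\<^sup>2 / 8 * c v) * c w + (if w = v then d\<^sup>2 / 2 * (c v)\<^sup>2 else 0))"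
    proof (rule sum.cong)
      fix w assume w: "w \<in> V"
      have "p v \<in> V" "p w \<in> V" "p v = p w \<longleftrightarrow> v = w"
        using p v w by (auto dest: inj_onD)
      then have "(p v - center) \<bullet> (p w - center) = (if v = w then 3/8 * d\<^sup>2 else - d\<^sup>2 / 8)"
        by (simp add: inner_centered_vertices)
      then show "c v * c w * ((p v - center) \<bullet> (p w - center))
        = - (d\<^sup>2 / 8 * c v) * c w + (if w = v then d\<^sup>2 / 2 * (c v)\<^sup>2 else 0)"
        by (auto simp: power2_eq_square field_simps)
    qed simp
    also have "\<dots> = - (d\<^sup>2 / 8 * c v) * sum c V + d\<^sup>2 / 2 * (c v)\<^sup>2"
      using v finite_V by (simp only: sum.distrib sum_distrib_left) simp
    finally show "(\<Sum>w\<in>V. c v * c w * ((p v - center) \<bullet> (p w - center))) = d\<^sup>2 / 2 * (c v)\<^sup>2"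
      using c by simp
  qed simp
  finally show ?thesis by (simp add: sum_distrib_left)
qed

definition vertex_extension :: "(real ^ 3 \<Rightarrow> real ^ 3) \<Rightarrow> real ^ 3 \<Rightarrow> real ^ 3"
  where "vertex_extension p x = (\<Sum>v\<in>V. bary v x *\<^sub>R p v)"

lemma vertex_extension_vertex:
  assumes "u \<in> V"
  shows "vertex_extension p u = p u"
proof -
  have "vertex_extension p u = (\<Sum>v\<in>V. if v = u then p v else 0)"
    unfolding vertex_extension_def using assms bary_vertex by (intro sum.cong) auto
  then show ?thesis using assms finite_V by simp
qed

lemma vertex_extension_symmetry:
  assumes p: "bij_betw p V V"
  shows "vertex_extension p \<in> carrier (symmetry_group (convex hull V))"
proof -
  have p': "p ` V \<subseteq> V" "inj_on p V" using p by (auto simp: bij_betw_def)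
  have "(dist (vertex_extension p x) (vertex_extension p y))\<^sup>2 = (dist x y)\<^sup>2" for x y
  proof -
    define c where "c v = bary v x - bary v y" for v
    have c: "sum c V = 0" by (simp add: c_def sum_subtractf bary_expansion)
    have "x - y = (\<Sum>v\<in>V. c v *\<^sub>R v)"
      by (simp add: c_def scaleR_diff_left sum_subtractf bary_expansion)
    moreover have "vertex_extension p x - vertex_extension p y = (\<Sum>v\<in>V. c v *\<^sub>R p v)"
      by (simp add: c_def vertex_extension_def scaleR_diff_left sum_subtractf)
    moreover have "(norm (\<Sum>v\<in>V. c v *\<^sub>R v))\<^sup>2 = d\<^sup>2 / 2 * (\<Sum>v\<in>V. (c v)\<^sup>2)"
      using norm_vertex_combination[OF c, of "\<lambda>v. v"] by simp
    ultimately show ?thesis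
      using norm_vertex_combination[OF c p'] by (simp only: dist_norm)
  qed
  then have iso: "vertex_extension p \<in> carrier isometry_group"
    by (intro isometry_groupI) simp
  have "vertex_extension p ` V = p ` V"
    by (simp add: vertex_extension_vertex)
  then have "vertex_extension p ` V = V"
    using p by (simp add: bij_betw_def)
  then show ?thesis
    using iso isometry_convex_hull_image[OF iso, of V] by (simp add: symmetry_group_def)
qed

text \<open>
  Numbering the vertices turns permutations of \<open>{1..4}\<close> into permutations of \<open>V\<close>, which extend
  uniquely to symmetries.
\<close>

lemma symmetry_group_iso_sym_group: "symmetry_group T \<cong> sym_group 4"
proof -
  let ?S = "symmetry_group T"
  obtain b where b: "bij_betw b {1..4::nat} V"
    using ex_bij_betw_nat_finite_1[OF finite_V] card_V by auto
  define b' where "b' = inv_into {1..4} b"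
  have b': "bij_betw b' V {1..4}"
    using b by (simp add: b'_def bij_betw_inv_into)
  have b'b: "b' (b i) = i" if "i \<in> {1..4}" for i
    using b that by (simp add: b'_def bij_betw_inv_into_left)
  have bb': "b (b' v) = v" if "v \<in> V" for v
    using b that by (simp add: b'_def bij_betw_inv_into_right)
  have symmetry_eqI: "f = g" if "f \<in> carrier ?S" "g \<in> carrier ?S" "\<And>i. i \<in> {1..4} \<Longrightarrow> f (b i) = g (b i)" for f g
  proof
    fix x
    have vertex: "f v = g v" if "v \<in> V" for v
      using that \<open>\<And>i. i \<in> {1..4} \<Longrightarrow> f (b i) = g (b i)\<close> b by (auto simp: bij_betw_def)
    have "f x = (\<Sum>v\<in>V. bary v x *\<^sub>R f v)"
      using symmetry_groupD(1)[OF that(1)] by (rule isometry_eq_vertex_combination)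
    also have "\<dots> = (\<Sum>v\<in>V. bary v x *\<^sub>R g v)"
      using vertex by simp
    also have "\<dots> = g x"
      using symmetry_groupD(1)[OF that(2)] by (rule isometry_eq_vertex_combination[symmetric])
    finally show "f x = g x" .
  qed
  define \<theta> where "\<theta> p = vertex_extension (b \<circ> p \<circ> b')" for p
  have \<theta>S: "\<theta> p \<in> carrier ?S" if "p permutes {1..4}" for p
    unfolding \<theta>_def
    by (intro vertex_extension_symmetry bij_betw_trans[of _ V "{1..4}"] bij_betw_trans[of _ "{1..4}" "{1..4}"])
      (use b b' permutes_imp_bij[OF that] in auto)
  have bV: "b i \<in> V" if "i \<in> {1..4}" for i using b that by (auto simp: bij_betw_def)
  have \<theta>b: "\<theta> p (b i) = b (p i)" if "i \<in> {1..4}" for p i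
    using that bV by (simp add: \<theta>_def vertex_extension_vertex b'b del: atLeastAtMost_iff)
  have "\<theta> \<in> iso (sym_group 4) ?S"
  proof (rule isoI)
    show "\<theta> \<in> hom (sym_group 4) ?S"
    proof (rule homI)
      fix p q assume "p \<in> carrier (sym_group 4)" "q \<in> carrier (sym_group 4)"
      then have pq: "p permutes {1..4}" "q permutes {1..4}" by (simp_all add: sym_group_carrier)
      have "\<theta> (p \<circ> q) = \<theta> p \<circ> \<theta> q"
      proof (rule symmetry_eqI)
        show "\<theta> (p \<circ> q) \<in> carrier ?S" using pq \<theta>S permutes_compose by blast
        show "\<theta> p \<circ> \<theta> q \<in> carrier ?S"
          using monoid.m_closed[OF group.is_monoid[OF group_symmetry_group] \<theta>S[OF pq(1)] \<theta>S[OF pq(2)]]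
          by simp
        show "\<theta> (p \<circ> q) (b i) = (\<theta> p \<circ> \<theta> q) (b i)" if "i \<in> {1..4}" for i
          using \<theta>b that permutes_in_image[OF pq(2)] by (simp del: atLeastAtMost_iff)
      qed
      then show "\<theta> (p \<otimes>\<^bsub>sym_group 4\<^esub> q) = \<theta> p \<otimes>\<^bsub>?S\<^esub> \<theta> q"
        by (simp add: sym_group_mult)
    qed (simp add: sym_group_carrier \<theta>S)
    show "bij_betw \<theta> (carrier (sym_group 4)) (carrier ?S)"
    proof (rule bij_betwI')
      fix p q assume "p \<in> carrier (sym_group 4)" "q \<in> carrier (sym_group 4)"
      then have pq: "p permutes {1..4}" "q permutes {1..4}" by (simp_all add: sym_group_carrier)
      show "\<theta> p = \<theta> q \<longleftrightarrow> p = q"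
      proof
        assume "\<theta> p = \<theta> q"
        then have "b (p i) = b (q i)" if "i \<in> {1..4}" for i
          using \<theta>b that by metis
        then have "p i = q i" if "i \<in> {1..4}" for i
          using that b'b permutes_in_image[OF pq(1)] permutes_in_image[OF pq(2)] by metis
        then show "p = q"
          using pq by (intro ext) (metis permutes_not_in)
      qed simp
    next
      fix a assume a: "a \<in> carrier ?S"
      define p where "p i = (if i \<in> {1..4} then b' (a (b i)) else i)" for i
      have "bij_betw a V V"
        using symmetry_image_V[OF a] isometry_groupD(1)[OF symmetry_groupD(1)[OF a]]
        by (metis bij_betw_def bij_is_inj inj_on_subset subset_UNIV)
      then have "bij_betw (b' \<circ> (a \<circ> b)) {1..4} {1..4}"
        using b b' by (intro bij_betw_trans[of _ _ V]) auto
      then have "bij_betw p {1..4} {1..4}"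
        by (rule bij_betw_cong[THEN iffD1, rotated]) (simp add: p_def)
      then have p: "p permutes {1..4}"
        by (rule bij_imp_permutes) (simp only: p_def if_False)
      moreover have "a = \<theta> p"
      proof (rule symmetry_eqI[OF a \<theta>S[OF p]])
        fix i assume i: "i \<in> {1..4::nat}"
        then have "a (b i) \<in> V" using bV symmetry_image_V[OF a] by blast
        then show "a (b i) = \<theta> p (b i)"
          using i \<theta>b bb' by (simp add: p_def del: atLeastAtMost_iff)
      qed
      ultimately show "\<exists>p \<in> carrier (sym_group 4). a = \<theta> p"
        by (auto simp: sym_group_carrier)
    qed (simp add: sym_group_carrier \<theta>S)
  qed
  then show ?thesis
    using group.iso_sym[OF sym_group_is_group] by (auto simp: is_iso_def)
qed

end

section \<open>Relabelling the factors of a free power\<close>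

abbreviation relabel :: "('i \<Rightarrow> 'j) \<Rightarrow> ('i \<times> 'a) list \<Rightarrow> ('j \<times> 'a) list"
  where "relabel \<sigma> \<equiv> map (\<lambda>(i, g). (\<sigma> i, g))"

lemma relabel_reduced:
  assumes "inj \<sigma>" "\<sigma> ` I \<subseteq> J" "w \<in> reduced_words I (\<lambda>_. G)"
  shows "relabel \<sigma> w \<in> reduced_words J (\<lambda>_. G)"
  using assms(3)
proof (induction w)
  case (Cons x w)
  then show ?case
    using assms(1,2) by (cases x; cases w) (auto simp: Cons_reduced dest: injD)
qed simp

text \<open>
  Injectivity ensures that the relabelling neither creates nor destroys cancellations.
\<close>

lemma relabel_fp_cons:
  assumes "inj \<sigma>"
  shows "relabel \<sigma> (fp_cons (\<lambda>_. G) (i, g) w) = fp_cons (\<lambda>_. G) (\<sigma> i, g) (relabel \<sigma> w)"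
  using assms by (cases w) (auto dest: injD)

lemma relabel_mult:
  assumes "inj \<sigma>"
  shows "relabel \<sigma> (foldr (fp_cons (\<lambda>_. G)) v w)
    = foldr (fp_cons (\<lambda>_. G)) (relabel \<sigma> v) (relabel \<sigma> w)"
  using assms by (induction v) (auto simp: relabel_fp_cons)

text \<open>
  Being an automorphism of the free product and being compatible with composition both come from
  the functoriality of relabelling; the inverse symmetry provides the inverse automorphism.
\<close>

lemma facet_action_hom:
  fixes T :: "'a::euclidean_space set"
  assumes facet: "\<And>a F. a \<in> carrier (symmetry_group T) \<Longrightarrow> F \<in> facets T \<Longrightarrow> a ` F \<in> facets T"
  shows "facet_action T \<in> hom (symmetry_group T) (AutoGroup (facet_free_product T))"
proof -
  let ?S = "symmetry_group T" and ?N = "facet_free_product T"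
  interpret S: group ?S by (rule group_symmetry_group)
  have inj: "inj ((`) a)" if "a \<in> carrier ?S" for a
    using isometry_groupD(1)[OF symmetry_groupD(1)[OF that]] 
    by (intro injI) (simp add: bij_is_inj inj_image_eq_iff)
  have closed: "relabel ((`) a) w \<in> carrier ?N"
    if "a \<in> carrier ?S" "w \<in> carrier ?N" for a w
    using relabel_reduced[OF inj[OF that(1)], of "facets T" "facets T"] facet that
    by (auto simp: facet_free_product_def)
  have comp: "relabel ((`) a) (relabel ((`) b) w) = relabel ((`) (a \<circ> b)) w"
    for a b :: "'a \<Rightarrow> 'a" and w :: "('a set \<times> int) list"
    by (auto simp: image_comp)
  have ident: "relabel ((`) id) w = w" for w :: "('a set \<times> int) list"
    by (induction w) auto
  have inverse: "relabel ((`) (inv\<^bsub>?S\<^esub> a)) (relabel ((`) a) w) = w"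
      "relabel ((`) a) (relabel ((`) (inv\<^bsub>?S\<^esub> a)) w) = w"
    if "a \<in> carrier ?S" for a and w :: "('a set \<times> int) list"
    unfolding comp using S.l_inv[OF that] S.r_inv[OF that] ident by simp_all
  have bij: "bij_betw (facet_action T a) (carrier ?N) (carrier ?N)" if a: "a \<in> carrier ?S" for a
    by (rule bij_betw_byWitness[where f' = "relabel ((`) (inv\<^bsub>?S\<^esub> a))"])
      (use a S.inv_closed[OF a] closed inverse in \<open>auto simp: facet_action_def\<close>)
  have "facet_action T a \<in> auto ?N" if a: "a \<in> carrier ?S" for a
  proof -
    have "facet_action T a \<in> hom ?N ?N"
    proof (rule homI)
      fix v w assume vw: "v \<in> carrier ?N" "w \<in> carrier ?N"
      have "group ?N"
        unfolding facet_free_product_def by (rule group_free_product) simp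
      then have "v \<otimes>\<^bsub>?N\<^esub> w \<in> carrier ?N"
        using vw by (simp add: group.is_monoid monoid.m_closed)
      then show "facet_action T a (v \<otimes>\<^bsub>?N\<^esub> w) = facet_action T a v \<otimes>\<^bsub>?N\<^esub> facet_action T a w"
        using vw relabel_mult[OF inj[OF a]]
        by (simp add: facet_action_def) (simp add: facet_free_product_def)
    qed (use closed a in \<open>simp add: facet_action_def\<close>)
    moreover have "facet_action T a \<in> extensional (carrier ?N)"
      by (simp add: facet_action_def)
    ultimately show ?thesis
      using bij[OF a] by (simp add: auto_def Bij_def)
  qed
  moreover have "facet_action T (a \<circ> b) = compose (carrier ?N) (facet_action T a) (facet_action T b)"
    if "a \<in> carrier ?S" "b \<in> carrier ?S" for a b
    using closed that comp by (intro ext) (auto simp: facet_action_def compose_def)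
  ultimately show ?thesis
    by (auto simp: hom_def AutoGroup_def BijGroup_def auto_def)
qed

section \<open>Evaluating words of reflections\<close>

text \<open>
  The second component of a letter is ignored: in a reduced word it is the nontrivial element of
  \<open>\<int>/2\<close>.
\<close>

definition word_isometry :: "('a::euclidean_space set \<times> int) list \<Rightarrow> 'a \<Rightarrow> 'a"
  where "word_isometry w = foldr (\<lambda>(F, _). (\<circ>) (facet_reflection F)) w id"

lemma word_isometry_simps [simp]:
  "word_isometry [] = id"
  "word_isometry ((F, g) # w) = facet_reflection F \<circ> word_isometry w"
  by (simp_all add: word_isometry_def)

lemma facet_word_letter:
  assumes "(F, g) # w \<in> carrier (facet_free_product T)"
  shows "g = 1" "F \<in> facets T" "w \<in> carrier (facet_free_product T)" "w = [] \<or> fst (hd w) \<noteq> F"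
  using assms by (auto simp: facet_free_product_def Cons_reduced carrier_integer_mod_group)

lemma word_isometry_relabel:
  assumes a: "a \<in> carrier isometry_group" and w: "w \<in> carrier (facet_free_product T)"
  shows "word_isometry (relabel ((`) a) w) \<circ> a = a \<circ> word_isometry w"
  using w
proof (induction w)
  case (Cons x w)
  obtain F g where x: "x = (F, g)" by fastforce
  have "F \<noteq> {}"
    using facet_word_letter(2)[OF Cons.prems[unfolded x]] by (simp add: facets_def facet_of_def)
  then have "facet_reflection (a ` F) \<circ> a = a \<circ> facet_reflection F"
    using facet_reflection_isometry_image[OF a, of F] by (simp add: fun_eq_iff)
  moreover have "word_isometry (relabel ((`) a) w) \<circ> a = a \<circ> word_isometry w"
    by (rule Cons.IH) (rule facet_word_letter(3)[OF Cons.prems[unfolded x]])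
  ultimately show ?case
    by (simp add: x fun_eq_iff)
qed simp

context equidistant_quadruple
begin

lemma facet_reflection_comp_self:
  assumes "F \<in> facets T"
  shows "facet_reflection F \<circ> facet_reflection F = id"
  using assms facet_reflection_involution facets_eq by fastforce

text \<open>
  The only relation of the free product is that a generator squares to one, and the reflections
  satisfy it.  This is what makes the evaluation of words multiplicative.
\<close>

lemma word_isometry_fp_cons:
  assumes "F \<in> facets T" "w \<in> carrier (facet_free_product T)"
  shows "word_isometry (fp_cons (\<lambda>_. integer_mod_group 2) (F, 1) w)
    = facet_reflection F \<circ> word_isometry w"
proof (cases w)
  case (Cons x u)
  obtain E g where x: "x = (E, g)" by fastforce
  have "g = 1" using assms facet_word_letter(1) by (metis Cons x)
  then show ?thesis
    using facet_reflection_comp_self[OF assms(1)] by (auto simp: Cons x comp_assoc[symmetric])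
qed simp

lemma word_isometry_hom: "word_isometry \<in> hom (facet_free_product T) isometry_group"
proof (rule homI)
  let ?N = "facet_free_product T"
  interpret group "isometry_group :: (real ^ 3 \<Rightarrow> real ^ 3) monoid" by (rule group_isometry_group)
  interpret N: group ?N
    unfolding facet_free_product_def by (rule group_free_product) simp
  show "word_isometry w \<in> carrier isometry_group" if "w \<in> carrier ?N" for w
    using that
  proof (induction w)
    case Nil
    show ?case using one_closed by (simp only: word_isometry_simps one_isometry_group)
  next
    case (Cons x w)
    obtain F g where x: "x = (F, g)" by fastforce
    have "facet_reflection F \<in> carrier isometry_group"
      using generators_subset facet_word_letter(2)[OF Cons.prems[unfolded x]] by blast
    moreover have "word_isometry w \<in> carrier isometry_group"
      by (rule Cons.IH) (rule facet_word_letter(3)[OF Cons.prems[unfolded x]])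
    ultimately have "facet_reflection F \<otimes>\<^bsub>isometry_group\<^esub> word_isometry w \<in> carrier isometry_group"
      by (rule m_closed)
    then show ?case
      by (simp only: x word_isometry_simps mult_isometry_group)
  qed
  show "word_isometry (v \<otimes>\<^bsub>?N\<^esub> w) = word_isometry v \<otimes>\<^bsub>isometry_group\<^esub> word_isometry w"
    if "v \<in> carrier ?N" and w: "w \<in> carrier ?N" for v w
    using that(1)
  proof (induction v)
    case Nil
    show ?case by (simp add: facet_free_product_def)
  next
    case (Cons x v)
    obtain F g where x: "x = (F, g)" by fastforce
    note letter = facet_word_letter[OF Cons.prems[unfolded x]]
    have "(x # v) \<otimes>\<^bsub>?N\<^esub> w = fp_cons (\<lambda>_. integer_mod_group 2) (F, 1) (v \<otimes>\<^bsub>?N\<^esub> w)"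
      using letter(1) by (simp add: x facet_free_product_def)
    then show ?case
      using word_isometry_fp_cons[OF letter(2) N.m_closed[OF letter(3) w]] Cons.IH[OF letter(3)]
      by (simp add: x comp_assoc)
  qed
qed

section \<open>Reduced words and their denominators\<close>

text \<open>
  The invariant of the \<open>3\<close>-adic argument.  Scaled by \<open>3 ^ length w\<close>, the coordinates become
  integers that are not divisible by 3.  The coordinate of the vertex opposite to the first facet
  of \<open>w\<close> is exempt: it has just been negated, so its denominator has not grown.
  The suitable starting vertex \<open>v\<close> is the one opposite to the last facet of \<open>w\<close>.
\<close>

lemma word_isometry_denominator:
  assumes "w \<in> carrier (facet_free_product T)" "w \<noteq> []"
  shows "\<exists>v \<in> V. \<forall>u \<in> V. \<exists>c :: int. 3 ^ length w * bary u (word_isometry w v) = of_int c \<and>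
    (opposite_facet u \<noteq> fst (hd w) \<longrightarrow> \<not> 3 dvd c)"
  using assms
proof (induction w)
  case (Cons x w)
  obtain F g where x: "x = (F, g)" by fastforce
  note letter = facet_word_letter[OF Cons.prems(1)[unfolded x]]
  obtain t where t: "t \<in> V" "F = opposite_facet t" using letter(2) facets_eq by auto
  \<comment> \<open>Only non-divisibility at \<open>t\<close> matters for the next letter.  For empty \<open>w\<close> take \<open>v = t\<close>, whose
    own coordinate is 1; otherwise reducedness ensures that \<open>t\<close> is not the exceptional vertex.\<close>
  have "\<exists>v \<in> V. \<forall>u \<in> V. \<exists>c :: int. 3 ^ length w * bary u (word_isometry w v) = of_int c \<and>
    (u = t \<longrightarrow> \<not> 3 dvd c)"
  proof (cases "w = []")
    case True
    show ?thesis
      by (rule bexI[of _ t]) (use t True bary_vertex in \<open>auto intro: exI[of _ 0] exI[of _ 1]\<close>)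
  next
    case False
    then have "opposite_facet t \<noteq> fst (hd w)"
      using letter(4) t by auto
    then show ?thesis
      using Cons.IH[OF letter(3) False] by metis
  qed
  then obtain v where v: "v \<in> V"
    and coord: "\<forall>u \<in> V. \<exists>c :: int. 3 ^ length w * bary u (word_isometry w v) = of_int c \<and>
      (u = t \<longrightarrow> \<not> 3 dvd c)"
    by blast
  obtain b :: int where b: "3 ^ length w * bary t (word_isometry w v) = of_int b" "\<not> 3 dvd b"
    using coord t by blast
  have "\<exists>c :: int. 3 ^ length (x # w) * bary u (word_isometry (x # w) v) = of_int c \<and>
      (opposite_facet u \<noteq> fst (hd (x # w)) \<longrightarrow> \<not> 3 dvd c)" if u: "u \<in> V" for u
  proof (cases "u = t")
    case True
    then show ?thesis
      using b t by (intro exI[of _ "-3 * b"]) (simp add: x bary_facet_reflection)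
  next
    case False
    obtain c :: int where c: "3 ^ length w * bary u (word_isometry w v) = of_int c"
      using coord u by blast
    have "3 ^ length (x # w) * bary u (word_isometry (x # w) v)
        = 3 * (3 ^ length w * bary u (word_isometry w v))
          + 2 * (3 ^ length w * bary t (word_isometry w v))"
      using u t False by (simp add: x bary_facet_reflection algebra_simps)
    then have "3 ^ length (x # w) * bary u (word_isometry (x # w) v) = of_int (3 * c + 2 * b)"
      by (simp only: b c)
    moreover have "\<not> 3 dvd 3 * c + 2 * b"
      using b(2) by presburger
    ultimately show ?thesis by blast
  qed
  then show ?case using v by blast
qed simp

text \<open>
  A symmetry maps vertices to vertices, and the coordinates of a vertex are 0 and 1.  Scaled by a
  positive power of 3 they are all divisible by 3, which contradicts the invariant.
\<close>

lemma word_isometry_symmetry_imp_Nil: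
  assumes w: "w \<in> carrier (facet_free_product T)"
    and sym: "word_isometry w \<in> carrier (symmetry_group T)"
  shows "w = []"
proof (rule ccontr)
  assume ne: "w \<noteq> []"
  then obtain v where v: "v \<in> V"
    and coord: "\<forall>u \<in> V. \<exists>c :: int. 3 ^ length w * bary u (word_isometry w v) = of_int c \<and>
      (opposite_facet u \<noteq> fst (hd w) \<longrightarrow> \<not> 3 dvd c)"
    using word_isometry_denominator[OF w] by blast
  obtain F g w' where w': "w = (F, g) # w'" using ne by (metis list.exhaust surj_pair)
  then obtain t where t: "t \<in> V" "F = opposite_facet t"
    using facet_word_letter(2) w facets_eq by blast
  \<comment> \<open>Any coordinate but the exceptional one gives the contradiction.\<close>
  obtain u where u: "u \<in> V" "u \<noteq> t" using exists_other_vertex by blast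
  then have "opposite_facet u \<noteq> fst (hd w)"
    using inj_on_opposite_facet t by (auto simp: w' dest: inj_onD)
  then obtain c :: int where c: "3 ^ length w * bary u (word_isometry w v) = of_int c" "\<not> 3 dvd c"
    using coord u by blast
  have "word_isometry w v \<in> V"
    using symmetry_image_V[OF sym] v by blast
  then have "c = 0 \<or> c = 3 ^ length w"
    using c(1) bary_vertex[OF u(1)] by (auto split: if_splits)
  then show False
    using c(2) ne by auto
qed

section \<open>The semidirect product decomposition\<close>

lemma symmetry_image_facet:
  assumes "a \<in> carrier (symmetry_group T)" "F \<in> facets T"
  shows "a ` F \<in> facets T"
proof -
  obtain u where u: "u \<in> V" "F = opposite_facet u" using assms(2) facets_eq by auto
  have "a ` (V - {u}) = V - {a u}"
    using symmetry_image_V[OF assms(1)] isometry_groupD(1)[OF symmetry_groupD(1)[OF assms(1)]]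
    by (simp add: image_set_diff bij_is_inj)
  then have "a ` F = opposite_facet (a u)"
    using isometry_convex_hull_image[OF symmetry_groupD(1)[OF assms(1)]]
    by (simp add: u opposite_facet_def)
  then show ?thesis
    using u symmetry_image_V[OF assms(1)] facets_eq by auto
qed

text \<open>
  The action by relabelling was chosen so that the relation
  \<open>word_isometry (facet_action T a w) \<circ> a = a \<circ> word_isometry w\<close> holds, which is what
  multiplicativity of this map requires.  The kernel is trivial because a word that evaluates to
  the inverse of a symmetry is empty.
\<close>

lemma semidirect_product_iso:
  "(\<lambda>(w, a). word_isometry w \<circ> a) \<in>
    iso (semidirect_product (facet_free_product T) (symmetry_group T) (facet_action T)) (tetrahedron_group T)"
proof -
  let ?N = "facet_free_product T" and ?S = "symmetry_group T"
  let ?P = "semidirect_product ?N ?S (facet_action T)"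
  let ?gens = "carrier ?S \<union> facet_reflection ` facets T"
  let ?I = "isometry_group :: (real ^ 3 \<Rightarrow> real ^ 3) monoid"
  define \<phi> where "\<phi> = (\<lambda>(w, a). word_isometry w \<circ> (a :: real ^ 3 \<Rightarrow> real ^ 3))"
  interpret I: group ?I by (rule group_isometry_group)
  interpret S: group ?S by (rule group_symmetry_group)
  have N: "group ?N"
    unfolding facet_free_product_def by (rule group_free_product) simp
  have word_mult: "word_isometry (v \<otimes>\<^bsub>?N\<^esub> w) = word_isometry v \<circ> word_isometry w"
    if "v \<in> carrier ?N" "w \<in> carrier ?N" for v w
    using hom_mult[OF word_isometry_hom that] by simp
  have act: "facet_action T \<in> hom ?S (AutoGroup ?N)"
    using symmetry_image_facet by (rule facet_action_hom)
  have act_closed: "facet_action T a w \<in> carrier ?N" if "a \<in> carrier ?S" "w \<in> carrier ?N" for a w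
    using act that by (auto simp: hom_def[of ?S] AutoGroup_def auto_def hom_def)
  have hom: "\<phi> \<in> hom ?P ?I"
  proof (rule homI)
    fix x assume "x \<in> carrier ?P"
    then obtain w a where x: "x = (w, a)" "w \<in> carrier ?N" "a \<in> carrier ?S"
      by (auto simp: semidirect_product_def)
    have "word_isometry w \<otimes>\<^bsub>?I\<^esub> a \<in> carrier ?I"
      using hom_in_carrier[OF word_isometry_hom x(2)] symmetry_groupD(1)[OF x(3)] by (rule I.m_closed)
    then show "\<phi> x \<in> carrier ?I"
      by (simp only: x \<phi>_def mult_isometry_group prod.case)
  next
    fix x y assume "x \<in> carrier ?P" "y \<in> carrier ?P"
    then obtain v a w b where x: "x = (v, a)" "v \<in> carrier ?N" "a \<in> carrier ?S"
      and y: "y = (w, b)" "w \<in> carrier ?N" "b \<in> carrier ?S"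
      by (auto simp: semidirect_product_def)
    have "word_isometry (facet_action T a w) \<circ> a = a \<circ> word_isometry w"
      using word_isometry_relabel[OF symmetry_groupD(1)[OF x(3)] y(2)] y(2)
      by (simp add: facet_action_def)
    then have "word_isometry v \<circ> word_isometry (facet_action T a w) \<circ> (a \<circ> b)
        = (word_isometry v \<circ> a) \<circ> (word_isometry w \<circ> b)"
      by (simp add: fun_eq_iff)
    then show "\<phi> (x \<otimes>\<^bsub>?P\<^esub> y) = \<phi> x \<otimes>\<^bsub>?I\<^esub> \<phi> y"
      using x y act_closed by (simp add: \<phi>_def semidirect_product_def word_mult)
  qed
  interpret hom: group_hom ?P ?I \<phi>
    using group_semidirect_product[OF N S.is_group act] hom I.is_group
    by (simp add: group_hom_def group_hom_axioms_def)
  have "inj_on \<phi> (carrier ?P)"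
    unfolding hom.inj_on_one_iff
  proof (intro allI impI)
    fix x assume x: "x \<in> carrier ?P" "\<phi> x = \<one>\<^bsub>?I\<^esub>"
    then obtain w a where wa: "x = (w, a)" "w \<in> carrier ?N" "a \<in> carrier ?S"
      by (auto simp: semidirect_product_def)
    have eq: "word_isometry w \<circ> a = id"
      using x wa by (simp add: \<phi>_def)
    have "a \<circ> inv\<^bsub>?S\<^esub> a = id"
      using S.r_inv[OF wa(3)] by simp
    then have "word_isometry w = inv\<^bsub>?S\<^esub> a"
      using eq comp_assoc[of "word_isometry w" a "inv\<^bsub>?S\<^esub> a"] by simp
    then have "w = []"
      using word_isometry_symmetry_imp_Nil wa by simp
    then show "x = \<one>\<^bsub>?P\<^esub>"
      using eq by (simp add: wa semidirect_product_def facet_free_product_def)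
  qed
  moreover have "\<phi> ` carrier ?P = carrier (tetrahedron_group T)"
  proof -
    have gens: "carrier ?I \<inter> ?gens = ?gens"
      using generators_subset by blast
    have "generate ?I ?gens \<subseteq> \<phi> ` carrier ?P"
    proof (rule I.generate_subgroup_incl[OF _ hom.img_is_subgroup])
      have "a \<in> \<phi> ` carrier ?P" if "a \<in> carrier ?S" for a
        using that by (intro image_eqI[of _ _ "([], a)"])
          (auto simp: \<phi>_def semidirect_product_def facet_free_product_def)
      moreover have "facet_reflection F \<in> \<phi> ` carrier ?P" if "F \<in> facets T" for F
        using that S.one_closed by (intro image_eqI[of _ _ "([(F, 1)], id)"])
          (auto simp: \<phi>_def semidirect_product_def facet_free_product_def Cons_reduced)
      ultimately show "?gens \<subseteq> \<phi> ` carrier ?P" by blast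
    qed
    moreover have "word_isometry w \<in> generate ?I ?gens" if "w \<in> carrier ?N" for w
      using that
    proof (induction w)
      case Nil
      show ?case using generate.one[of ?I ?gens] by (simp only: word_isometry_simps one_isometry_group)
    next
      case (Cons x w)
      obtain F g where x: "x = (F, g)" by fastforce
      note letter = facet_word_letter[OF Cons.prems[unfolded x]]
      have "facet_reflection F \<in> generate ?I ?gens"
        using letter(2) by (intro generate.incl) blast
      then have "facet_reflection F \<otimes>\<^bsub>?I\<^esub> word_isometry w \<in> generate ?I ?gens"
        using Cons.IH[OF letter(3)] by (rule generate.eng)
      then show ?case
        by (simp only: x word_isometry_simps mult_isometry_group)
    qed
    then have "word_isometry w \<otimes>\<^bsub>?I\<^esub> a \<in> generate ?I ?gens"
      if "w \<in> carrier ?N" "a \<in> carrier ?S" for w a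
      using that by (intro generate.eng[OF _ generate.incl]) auto
    then have "\<phi> ` carrier ?P \<subseteq> generate ?I ?gens"
      by (auto simp: \<phi>_def semidirect_product_def)
    ultimately show ?thesis
      by (simp add: tetrahedron_group_def carrier_subgroup_generated gens)
  qed
  moreover have "\<phi> \<in> hom ?P (tetrahedron_group T)"
    using hom calculation(2)
    by (auto simp: hom_def tetrahedron_group_def subgroup_generated_def)
  ultimately show ?thesis
    unfolding \<phi>_def[symmetric] by (simp add: iso_def bij_betw_def)
qed

end

theorem theorem5p9:
  fixes T :: "(real ^ 3) set"
  assumes "regular_tetrahedron T"
  shows "card (facets T) = 4
    \<and> symmetry_group T \<cong> sym_group 4
    \<and> facet_action T \<in> hom (symmetry_group T) (AutoGroup (facet_free_product T))
    \<and> (\<exists>\<phi> \<in> iso (semidirect_product (facet_free_product T) (symmetry_group T) (facet_action T))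
                 (tetrahedron_group T).
          (\<forall>F \<in> facets T. \<phi> (facet_generator F, \<one>\<^bsub>symmetry_group T\<^esub>) = facet_reflection F)
        \<and> (\<forall>a \<in> carrier (symmetry_group T). \<phi> (\<one>\<^bsub>facet_free_product T\<^esub>, a) = a))"
proof -
  obtain V d where V: "card V = 4" "pairwise (\<lambda>x y. dist x y = d) V" and T: "T = convex hull V"
    using assms by (auto simp: regular_tetrahedron_def)
  interpret equidistant_quadruple V d
    using V by unfold_locales
  have "card (facets T) = 4"
    using card_V by (simp add: T facets_eq card_image inj_on_opposite_facet)
  moreover have "facet_action T \<in> hom (symmetry_group T) (AutoGroup (facet_free_product T))"
    using symmetry_image_facet facet_action_hom unfolding T by blast
  moreover have "\<exists>\<phi> \<in> iso (semidirect_product (facet_free_product T) (symmetry_group T) (facet_action T))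
                 (tetrahedron_group T).
          (\<forall>F \<in> facets T. \<phi> (facet_generator F, \<one>\<^bsub>symmetry_group T\<^esub>) = facet_reflection F)
        \<and> (\<forall>a \<in> carrier (symmetry_group T). \<phi> (\<one>\<^bsub>facet_free_product T\<^esub>, a) = a)"
    using semidirect_product_iso unfolding T
    by (rule rev_bexI) (simp add: facet_generator_def fp_inj_def facet_free_product_def)
  ultimately show ?thesis
    using symmetry_group_iso_sym_group T by blast
qed

end
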